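(* Let $F(z)\in\mathbb{Z}[[z]]$ be the power series with $F(0)=1$ satisfying $F(z)=(1+z+z^2)F(z^4)-z^4F(z^{16})$, let $\rho=(1+\sqrt5)/2$ and let $\lg$ denote the base-$2$ logarithm. Then there is a positive function $C(z)$ on $(0,1)$ which is bounded away from $0$ and $\infty$ on $(0,1)$, real analytic on $(0,1)$, and satisfies $C(z)=C(z^4)$, such that, as $z\to1^-$, $$F(z)=\frac{C(z)}{(1-z)^{\lg\rho}}\,\bigl(1+O(1-z)\bigr).$$
   Context: The functional equation together with $F(0)=1$ determines $F$ uniquely as a power series convergent in the open unit disc. *)

theory Defs
  imports "HOL-Analysis.Analysis" "HOL-Library.Landau_Symbols"
begin

definition real_fps :: "int fps \<Rightarrow> real fps" where
  "real_fps F = Abs_fps (\<lambda>n. real_of_int (fps_nth F n))"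

definition real_analytic_on :: "(real \<Rightarrow> real) \<Rightarrow> real set \<Rightarrow> bool" (infixl \<open>real'_analytic'_on\<close> 50)
  where "f real_analytic_on S \<longleftrightarrow>
    (\<forall>x\<in>S. \<exists>p :: real fps. (\<lambda>t. f (x + t)) has_fps_expansion p)"

end

theory Submission
  imports Defs "HOL-Complex_Analysis.Complex_Analysis"
begin

text \<open>
  The functional equation forces all coefficients of \<open>F\<close> to be 0 or 1, so \<open>F\<close> is holomorphic in the
  unit disc and increasing on \<open>[0, 1)\<close>. Put \<open>\<beta> = \<rho>\<^sup>-\<^sup>2\<close>, \<open>t = - ln z\<close> and
  \<open>b\<^sub>n(t) = \<beta>\<^sup>n F(exp(- t / 4\<^sup>n))\<close>. The functional equation becomes a second-order linear recurrence
  for \<open>b\<^sub>n\<close> whose coefficients differ by \<open>O(4\<^sup>-\<^sup>n)\<close> from constant ones with characteristic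
  roots \<open>1\<close> and \<open>\<beta>\<^sup>2 < 1/4\<close>. Hence \<open>b\<^sub>n\<close> converges to some \<open>\<Phi>\<close> with error \<open>O(4\<^sup>-\<^sup>n)\<close>, locally
  uniformly on the right half-plane; \<open>\<Phi>\<close> is holomorphic and \<open>\<Phi>(t / 4) = \<rho>\<^sup>2 \<Phi>(t)\<close>. Monotonicity of
  \<open>F\<close> excludes the recessive solution, so \<open>\<Phi> > 0\<close> on the positive reals.
  Then \<open>C(z) = t powr (lg \<rho>) * \<Phi>(t)\<close> is invariant under \<open>t |-> 4 t\<close>, so bounds for it on
  \<open>1 \<le> t \<le> 4\<close> are global, and the same rescaling turns the error \<open>O(4\<^sup>-\<^sup>n)\<close> on this interval into
  \<open>F(exp(- t)) = \<Phi>(t) (1 + O(t))\<close> as \<open>t\<close> tends to 0.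
\<close>

section \<open>Power series with bounded coefficients and real parts of expansions\<close>

lemma fps_nth_compose_X_power:
  fixes F :: "'a :: comm_ring_1 fps"
  assumes "d > 0"
  shows "fps_nth (F oo fps_X ^ d) n = (if d dvd n then fps_nth F (n div d) else 0)"
proof -
  have "fps_nth (F oo fps_X ^ d) n = (\<Sum>i=0..n. if n = d * i then fps_nth F i else 0)"
    by (auto simp: fps_compose_nth fps_X_power_nth simp flip: power_mult intro!: sum.cong)
  also have "\<dots> = (if d dvd n then fps_nth F (n div d) else 0)"
  proof (cases "d dvd n")
    case True
    then obtain k where k: "n = d * k" by auto
    have "(\<Sum>i=0..n. if n = d * i then fps_nth F i else 0) = (\<Sum>i\<in>{k}. fps_nth F i)"
      using assms k by (intro sum.mono_neutral_cong_right) auto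
    then show ?thesis using True k assms by simp
  qed (auto intro!: sum.neutral)
  finally show ?thesis .
qed

lemma fps_conv_radius_ge_1:
  fixes P :: "'a :: {banach, real_normed_div_algebra} fps"
  assumes "\<And>n. norm (fps_nth P n) \<le> 1"
  shows "fps_conv_radius P \<ge> 1"
  unfolding fps_conv_radius_def
proof (rule conv_radius_geI_ex')
  fix r :: real assume r: "0 < r" "ereal r < 1"
  show "summable (\<lambda>n. fps_nth P n * of_real r ^ n)"
  proof (rule summable_comparison_test')
    show "summable (\<lambda>n. r ^ n)" using r by (intro summable_geometric) auto
    show "norm (fps_nth P n * of_real r ^ n) \<le> r ^ n" for n
      using r assms[of n] by (simp add: norm_mult norm_power mult_left_le_one_le)
  qed
qed

text \<open>For real \<open>u\<close> the powers of \<open>u\<close> are real, so \<open>Re\<close>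
  can be taken coefficientwise, and the radius of convergence does not shrink. This turns complex
  analyticity into the real analyticity claimed for \<open>C\<close>.\<close>

lemma has_fps_expansion_Re:
  assumes "f has_fps_expansion P"
  shows "(\<lambda>u::real. Re (f (of_real u))) has_fps_expansion Abs_fps (\<lambda>n. Re (fps_nth P n))"
proof -
  define Q where "Q = Abs_fps (\<lambda>n. Re (fps_nth P n))"
  have P0: "fps_conv_radius P > 0" and ev: "eventually (\<lambda>z. eval_fps P z = f z) (nhds 0)"
    using assms by (auto simp: has_fps_expansion_def)
  have QP: "fps_conv_radius P \<le> fps_conv_radius Q"
    unfolding fps_conv_radius_def
  proof (rule conv_radius_geI_ex')
    fix r :: real assume r: "0 < r" "ereal r < conv_radius (fps_nth P)"
    have "summable (\<lambda>n. fps_nth P n * of_real r ^ n)"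
      by (rule summable_in_conv_radius) (use r in auto)
    from summable_Re[OF this] show "summable (\<lambda>n. fps_nth Q n * of_real r ^ n)"
      by (simp add: Q_def flip: of_real_power)
  qed
  have "eventually (\<lambda>u::real. eval_fps P (of_real u) = f (of_real u)) (nhds 0)"
    using tendsto_of_real[OF filterlim_ident, of "0::real"]
    by (intro eventually_compose_filterlim[OF ev]) auto
  moreover have "eventually (\<lambda>u. u \<in> eball 0 (fps_conv_radius P)) (nhds (0::real))"
    using P0 by (intro eventually_nhds_in_open) (auto simp: zero_ereal_def)
  ultimately have "eventually (\<lambda>u. eval_fps Q u = Re (f (of_real u))) (nhds 0)"
  proof eventually_elim
    case (elim u)
    have "(\<lambda>n. fps_nth P n * of_real u ^ n) sums f (of_real u)"
      using sums_eval_fps[of "of_real u" P] elim by auto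
    from sums_Re[OF this] have "(\<lambda>n. fps_nth Q n * u ^ n) sums Re (f (of_real u))"
      by (simp add: Q_def flip: of_real_power)
    then show ?case by (simp add: eval_fps_def sums_iff)
  qed
  with P0 QP show ?thesis unfolding has_fps_expansion_def Q_def by auto
qed

section \<open>Perturbed recurrences and geometric convergence\<close>

text \<open>The bound depends on the sequence only through \<open>K\<close> and \<open>A\<close>, which yields convergence
  that is uniform in parameters.  The potential \<open>norm (b (n + 1)) + norm (b (n + 1) - b n)\<close> grows by at
  most the factor \<open>1 + 4 K / 4 ^ n\<close>.\<close>
lemma perturbed_recurrence_bound:
  fixes K A :: real
  assumes "K \<ge> 0" "A \<ge> 0"
  obtains B where "B \<ge> 0"
    "\<And>(b :: nat \<Rightarrow> 'a :: real_normed_vector) n. norm (b 0) \<le> A \<Longrightarrow> norm (b 1) \<le> A \<Longrightarrow>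
       (\<And>n. norm (b (n+2) - b (n+1)) \<le> norm (b (n+1) - b n) / 6 + K / 4 ^ n * (norm (b (n+1)) + norm (b n)))
       \<Longrightarrow> norm (b (n+1) - b n) \<le> B / 4 ^ n"
proof -
  \<comment> \<open>\<open>M\<close> bounds the potential: it starts at most at
    \<open>3 * A\<close>, and its growth factors multiply to at most \<open>exp (8 * K)\<close>.
    \<open>B\<close> is large enough for \<open>d 0 \<le> B\<close> and for
    \<open>B / 6 + 2 * K * M \<le> B / 4\<close>, which closes the induction on
    \<open>d\<close>.\<close>
  define M where "M = 3 * A * exp (8 * K)"
  define B where "B = 12 * K * 2 * M + 2 * A"
  have M0: "M \<ge> 0" "B \<ge> 0" using assms by (auto simp: M_def B_def)
  have "norm (b (n+1) - b n) \<le> B / 4 ^ n"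
    if b: "norm (b 0) \<le> A" "norm (b 1) \<le> A" and
      rec: "\<And>n. norm (b (n+2) - b (n+1)) \<le> norm (b (n+1) - b n) / 6 + K / 4 ^ n * (norm (b (n+1)) + norm (b n))"
    for b :: "nat \<Rightarrow> 'a" and n
  proof -
    define d where "d n = norm (b (n+1) - b n)" for n
    define U where "U n = norm (b (n+1)) + d n" for n
    have d0: "d n \<ge> 0" for n by (simp add: d_def)
    have bU: "norm (b (n+1)) + norm (b n) \<le> 2 * U n" for n
    proof -
      have "norm (b n) \<le> norm (b (n+1)) + d n"
        using norm_triangle_ineq4[of "b (n+1)" "b (n+1) - b n"] by (simp add: d_def)
      then show ?thesis using d0[of n] by (simp add: U_def)
    qed
    have recd: "d (n+1) \<le> d n / 6 + K / 4 ^ n * (2 * U n)" for n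
    proof -
      have "K / 4 ^ n * (norm (b (n+1)) + norm (b n)) \<le> K / 4 ^ n * (2 * U n)"
        using bU[of n] assms by (intro mult_left_mono) auto
      then show ?thesis using rec[of n] by (simp add: d_def)
    qed
    have U0: "U n \<ge> 0" for n by (simp add: U_def d_def)
    have U_step: "U (n+1) \<le> exp (4 * K / 4 ^ n) * U n" for n
    proof -
      have "norm (b (n+2)) \<le> norm (b (n+1)) + d (n+1)"
        using norm_triangle_ineq[of "b (n+1)" "b (n+2) - b (n+1)"] by (simp add: d_def)
      then have "U (n+1) \<le> norm (b (n+1)) + 2 * d (n+1)" by (simp add: U_def)
      also have "\<dots> \<le> U n + 4 * K / 4 ^ n * U n"
      proof -
        have "K / 4 ^ n * (2 * U n) * 2 = 4 * K / 4 ^ n * U n" by simp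
        then show ?thesis using recd[of n] d0[of n] unfolding U_def[of n] by linarith
      qed
      also have "\<dots> = (1 + 4 * K / 4 ^ n) * U n" by (simp add: algebra_simps)
      also have "\<dots> \<le> exp (4 * K / 4 ^ n) * U n"
        by (intro mult_right_mono exp_ge_add_one_self U0)
      finally show ?thesis .
    qed
    have d0A: "d 0 \<le> 2 * A"
      using norm_triangle_ineq4[of "b 1" "b 0"] b by (simp add: d_def)
    \<comment> \<open>The exponent grows by \<open>6 * K / 4 ^ n\<close> per step, which leaves room
      for the factor \<open>exp (4 * K / 4 ^ n)\<close>.\<close>
    have "U n \<le> U 0 * exp (8 * K * (1 - 1 / 4 ^ n))" for n
    proof (induction n)
      case (Suc n)
      have "U (Suc n) \<le> exp (4 * K / 4 ^ n) * U n" using U_step[of n] by simp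
      also have "\<dots> \<le> exp (4 * K / 4 ^ n) * (U 0 * exp (8 * K * (1 - 1 / 4 ^ n)))"
        by (intro mult_left_mono Suc) auto
      also have "\<dots> = U 0 * exp (4 * K / 4 ^ n + 8 * K * (1 - 1 / 4 ^ n))"
        by (simp add: exp_add)
      also have "\<dots> \<le> U 0 * exp (8 * K * (1 - 1 / 4 ^ Suc n))"
        using assms by (intro mult_left_mono U0) (simp add: field_simps)
      finally show ?case .
    qed simp
    moreover have "U 0 * exp (8 * K * (1 - 1 / 4 ^ n)) \<le> 3 * A * exp (8 * K)" for n
      using d0A b assms by (intro mult_mono) (auto simp: U_def algebra_simps)
    ultimately have UM: "U n \<le> M" for n unfolding M_def using order_trans by blast
    have "d n \<le> B / 4 ^ n"
    proof (induction n)
      case 0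
      then show ?case using d0A mult_nonneg_nonneg[OF assms(1) M0(1)] by (simp add: B_def)
    next
      case (Suc n)
      have "d (Suc n) \<le> d n / 6 + K / 4 ^ n * (2 * U n)" using recd[of n] by simp
      also have "\<dots> \<le> (B / 4 ^ n) / 6 + K / 4 ^ n * (2 * M)"
        using Suc UM[of n] assms by (intro add_mono mult_left_mono divide_right_mono) auto
      also have "\<dots> = (B / 6 + 2 * K * M) / 4 ^ n" by (simp add: field_simps)
      also have "\<dots> \<le> (B / 4) / 4 ^ n"
        using assms by (intro divide_right_mono) (auto simp: B_def)
      also have "\<dots> = B / 4 ^ Suc n" by simp
      finally show ?case .
    qed
    then show ?thesis by (simp add: d_def)
  qed
  with M0 show ?thesis by (intro that[of B]) auto
qed

text \<open>Summing the increments from \<open>n\<close> on gives a geometric tail; the constant 2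
  rounds up \<open>4 / 3\<close>. Inside, the factor \<open>1 - 1 / 4 ^ k\<close> lets the bound on
  finite sums go through by induction.\<close>

lemma geometric_increments_limit:
  fixes b :: "nat \<Rightarrow> 'a :: banach"
  assumes "\<And>n. norm (b (n+1) - b n) \<le> B / 4 ^ n"
  shows "convergent b" "norm (lim b - b n) \<le> 2 * B / 4 ^ n"
proof -
  have B: "B \<ge> 0" using order_trans[OF norm_ge_zero assms[of 0]] by simp
  have step: "norm (b (n + k) - b n) \<le> 2 * B / 4 ^ n * (1 - 1 / 4 ^ k)" for n k
  proof (induction k)
    case (Suc k)
    have "norm (b (n + Suc k) - b n) \<le> norm (b (n + k + 1) - b (n + k)) + norm (b (n + k) - b n)"
      using norm_triangle_ineq[of "b (n + k + 1) - b (n + k)" "b (n + k) - b n"] by simp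
    also have "\<dots> \<le> B / 4 ^ (n + k) + 2 * B / 4 ^ n * (1 - 1 / 4 ^ k)"
      by (intro add_mono assms Suc)
    also have "\<dots> \<le> 2 * B / 4 ^ n * (1 - 1 / 4 ^ Suc k)"
      using B by (simp add: field_simps power_add)
    finally show ?case .
  qed simp
  have bd: "norm (b m - b n) \<le> 2 * B / 4 ^ n" if "m \<ge> n" for m n
  proof -
    have "2 * B / 4 ^ n * (1 - 1 / 4 ^ (m - n)) \<le> 2 * B / 4 ^ n * 1"
      using B by (intro mult_left_mono) auto
    then show ?thesis using step[of n "m - n"] that by simp
  qed
  have lim0: "(\<lambda>n. 2 * B / 4 ^ n) \<longlonglongrightarrow> 0"
    by (rule LIMSEQ_divide_realpow_zero) simp
  show conv: "convergent b"
  proof (rule Cauchy_convergent, rule CauchyI)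
    fix e :: real assume "e > 0"
    then have "eventually (\<lambda>n. 2 * B / 4 ^ n < e / 2) sequentially"
      using order_tendstoD(2)[OF lim0, of "e/2"] by simp
    then obtain N where N: "2 * B / 4 ^ N < e / 2" by (auto simp: eventually_sequentially)
    show "\<exists>M. \<forall>m\<ge>M. \<forall>n\<ge>M. norm (b m - b n) < e"
    proof (intro exI allI impI)
      fix m n assume "m \<ge> N" "n \<ge> N"
      then show "norm (b m - b n) < e"
        using bd[of N m] bd[of N n] N norm_triangle_ineq4[of "b m - b N" "b n - b N"] by simp
    qed
  qed
  then have "(\<lambda>m. b m - b n) \<longlonglongrightarrow> lim b - b n"
    by (intro tendsto_diff) (auto simp: convergent_LIMSEQ_iff)
  then show "norm (lim b - b n) \<le> 2 * B / 4 ^ n"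
    by (rule Lim_norm_ubound[OF sequentially_bot])
       (use bd in \<open>auto simp: eventually_sequentially intro!: exI[of _ n]\<close>)
qed

section \<open>The constant \<open>beta\<close> and elementary real estimates\<close>

text \<open>The smaller root of \<open>x^2 - 3 x + 1\<close>, the characteristic polynomial of the
  recurrence obtained by setting the polynomial coefficients of the functional equation to their
  values at \<open>z = 1\<close>.\<close>

definition beta :: real where "beta = (3 - sqrt 5) / 2"

lemma beta_eq: "beta ^ 2 = 3 * beta - 1"
  by (simp add: beta_def power2_eq_square field_simps)

text \<open>The bound \<open>2 / 5\<close> is sharp enough to give
  \<open>beta ^ 2 \<le> 1 / 6\<close>, so increments contract faster than the perturbation
  \<open>1 / 4 ^ n\<close> decays.\<close>

lemma beta_bounds: "0 < beta" "beta < 2 / 5"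
proof -
  have "sqrt 5 < 3" by (rule real_less_lsqrt) auto
  moreover have "11 / 5 < sqrt 5" by (rule real_less_rsqrt) (simp add: power2_eq_square)
  ultimately show "0 < beta" "beta < 2 / 5" by (auto simp: beta_def)
qed

abbreviation right_half_plane :: "complex set" where "right_half_plane \<equiv> {t. Re t > 0}"

text \<open>Take the least \<open>m\<close> with \<open>t * 4 ^ m \<ge> 1\<close>. The interval from
  1 to 4 represents all orbits of multiplication by 4, and compactness is available there.\<close>

lemma scale_to_fundamental_interval:
  fixes t :: real
  assumes "0 < t" "t \<le> 1"
  obtains s m where "s \<in> {1..4}" "t = s / 4 ^ m"
proof -
  define P where "P m \<longleftrightarrow> t * 4 ^ m \<ge> 1" for m :: nat
  obtain m0 where "1 / t < 4 ^ m0" using real_arch_pow[of 4 "1 / t"] by auto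
  then have "P m0" using assms by (simp add: P_def field_simps)
  define m where "m = (LEAST m. P m)"
  have Pm: "P m" unfolding m_def by (rule LeastI[of P, OF \<open>P m0\<close>])
  have "t * 4 ^ m \<le> 4"
  proof (cases m)
    case 0
    then show ?thesis using assms by simp
  next
    case (Suc k)
    then have "\<not> P k" using not_less_Least[of k P] by (simp add: m_def)
    then show ?thesis using Suc by (simp add: P_def)
  qed
  with Pm show ?thesis by (intro that[of "t * 4 ^ m" m]) (auto simp: P_def)
qed

text \<open>The base lies between \<open>z\<close> and 1, and an exponent in \<open>[0, 1]\<close>
  moves it towards 1. Hence replacing \<open>- ln z\<close> by \<open>1 - z\<close> in the final
  formula costs a relative error of at most \<open>1 - z\<close>.\<close>

lemma powr_quotient_neg_ln_bounds:
  fixes z a :: real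
  assumes "0 < z" "z < 1" "0 \<le> a" "a \<le> 1"
  defines "q \<equiv> ((1 - z) / (- ln z)) powr a"
  shows "z \<le> q" "q \<le> 1"
proof -
  have t: "- ln z \<ge> 1 - z" "- ln z \<le> (1 - z) / z" "- ln z > 0"
    using ln_le_minus_one[of z] ln_le_minus_one[of "1 / z"] assms
    by (auto simp: ln_div field_simps)
  then have r: "(1 - z) / (- ln z) \<le> 1" "z \<le> (1 - z) / (- ln z)"
    using assms by (auto simp: field_simps)
  show "q \<le> 1" unfolding q_def using r assms by (intro powr_le1) auto
  have "z = z powr 1" using assms by simp
  also have "\<dots> \<le> z powr a" using assms by (intro powr_mono') auto
  also have "\<dots> \<le> q" unfolding q_def using r assms by (intro powr_mono2) auto
  finally show "z \<le> q" .
qed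

section \<open>Coefficients of F\<close>

locale stern_series =
  fixes F :: "int fps"
  assumes F0: "fps_nth F 0 = 1"
    and F_eq: "F = (1 + fps_X + fps_X ^ 2) * (F oo fps_X ^ 4) - fps_X ^ 4 * (F oo fps_X ^ 16)"
begin

text \<open>Comparison of coefficients; the guards such as \<open>n \<ge> 1\<close> are there
  because subtraction of naturals truncates.\<close>

lemma nth_F:
  "fps_nth F n = (if 4 dvd n then fps_nth F (n div 4) else 0)
     + (if n \<ge> 1 \<and> 4 dvd (n - 1) then fps_nth F ((n - 1) div 4) else 0)
     + (if n \<ge> 2 \<and> 4 dvd (n - 2) then fps_nth F ((n - 2) div 4) else 0)
     - (if n \<ge> 4 \<and> 16 dvd (n - 4) then fps_nth F ((n - 4) div 16) else 0)"
proof -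
  have "fps_nth F n = fps_nth ((F oo fps_X ^ 4) + fps_X ^ 1 * (F oo fps_X ^ 4)
          + fps_X ^ 2 * (F oo fps_X ^ 4) - fps_X ^ 4 * (F oo fps_X ^ 16)) n"
    by (subst F_eq) (simp add: algebra_simps)
  then show ?thesis
    by (simp only: fps_add_nth fps_sub_nth fps_X_power_mult_nth) (auto simp: fps_nth_compose_X_power)
qed

text \<open>The negative term of \<open>nth_F\<close> occurs only for indices
  \<open>16 * k + 4\<close>. There it cancels the positive term exactly, because the coefficient at
  \<open>4 * k + 1\<close> equals the one at \<open>k\<close>.\<close>

lemma nth_F_mod:
  "fps_nth F (4 * k + 1) = fps_nth F k"
  "fps_nth F (4 * k + 2) = fps_nth F k"
  "fps_nth F (4 * k + 3) = 0"
  "fps_nth F (16 * k + 4) = 0"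
  "k mod 4 \<noteq> 1 \<Longrightarrow> fps_nth F (4 * k) = fps_nth F k"
proof -
  show 1: "fps_nth F (4 * k + 1) = fps_nth F k" for k
  proof -
    have "\<not> 4 dvd 4 * k + 1" "\<not> (4 * k + 1 \<ge> 2 \<and> 4 dvd (4 * k + 1 - 2))"
      "\<not> (4 * k + 1 \<ge> 4 \<and> 16 dvd (4 * k + 1 - 4))" by presburger+
    then show ?thesis by (subst nth_F) auto
  qed
  show "fps_nth F (4 * k + 2) = fps_nth F k"
  proof -
    have "\<not> 4 dvd 4 * k + 2" "\<not> (4 * k + 2 \<ge> 1 \<and> 4 dvd (4 * k + 2 - 1))"
      "\<not> (4 * k + 2 \<ge> 4 \<and> 16 dvd (4 * k + 2 - 4))" by presburger+
    then show ?thesis by (subst nth_F) auto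
  qed
  show "fps_nth F (4 * k + 3) = 0"
  proof -
    have "\<not> 4 dvd 4 * k + 3" "\<not> (4 * k + 3 \<ge> 1 \<and> 4 dvd (4 * k + 3 - 1))"
      "\<not> (4 * k + 3 \<ge> 2 \<and> 4 dvd (4 * k + 3 - 2))"
      "\<not> (4 * k + 3 \<ge> 4 \<and> 16 dvd (4 * k + 3 - 4))" by presburger+
    then show ?thesis by (subst nth_F) auto
  qed
  have 4: "fps_nth F (4 * j) = fps_nth F j - (if j mod 4 = 1 then fps_nth F ((j - 1) div 4) else 0)" for j
  proof -
    have "\<not> (4 * j \<ge> 1 \<and> 4 dvd (4 * j - 1))" "\<not> (4 * j \<ge> 2 \<and> 4 dvd (4 * j - 2))" by presburger+
    moreover have "(4 * j \<ge> 4 \<and> 16 dvd (4 * j - 4)) = (j mod 4 = 1)" by presburger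
    moreover have "(4 * j - 4) div 16 = (j - 1) div 4" by presburger
    ultimately show ?thesis by (subst nth_F) auto
  qed
  show "fps_nth F (16 * k + 4) = 0" using 4[of "4 * k + 1"] 1[of k] by (simp add: add.commute)
  show "k mod 4 \<noteq> 1 \<Longrightarrow> fps_nth F (4 * k) = fps_nth F k" using 4[of k] by simp
qed

text \<open>By \<open>nth_F_mod\<close> each coefficient is 0 or equals one of smaller index. Only
  index 0 does not descend, and there \<open>F0\<close> applies.\<close>

lemma nth_F_01: "fps_nth F n \<in> {0, 1}"
proof (induction n rule: less_induct)
  case (less n)
  define k where "k = n div 4"
  have k: "n = 4 * k \<or> n = 4 * k + 1 \<or> n = 4 * k + 2 \<or> n = 4 * k + 3"
    unfolding k_def by presburger
  show ?case
  proof (cases "n = 4 * k")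
    case True
    show ?thesis
    proof (cases "k mod 4 = 1")
      case True
      then have "n = 16 * (k div 4) + 4" using \<open>n = 4 * k\<close> by presburger
      then show ?thesis using nth_F_mod(4)[of "k div 4"] by simp
    next
      case False
      then show ?thesis using less.IH[of k] nth_F_mod(5)[of k] F0 True by (cases "k = 0") auto
    qed
  next
    case False
    then show ?thesis using k less.IH[of k] nth_F_mod(1-3)[of k] by auto
  qed
qed

lemma abs_nth_F_le_1: "\<bar>of_int (fps_nth F n) :: real\<bar> \<le> 1"
  using nth_F_01[of n] by auto

section \<open>The functional equation in the unit disc\<close>

definition cF :: "complex fps" where "cF = Abs_fps (\<lambda>n. of_int (fps_nth F n))"

lemma conv_radius_cF: "fps_conv_radius cF \<ge> 1"
  using abs_nth_F_le_1 by (intro fps_conv_radius_ge_1) (simp add: cF_def)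

lemma conv_radius_real_F: "fps_conv_radius (real_fps F) \<ge> 1"
  using abs_nth_F_le_1 by (intro fps_conv_radius_ge_1) (simp add: real_fps_def)

text \<open>The composite carries the coefficients of \<open>cF\<close> at the multiples of
  \<open>d\<close> and zeros elsewhere, so its value follows by reindexing the series along
  \<open>n \<mapsto> d * n\<close>.\<close>

lemma eval_cF_compose_power:
  assumes "norm z < 1" "d > 0"
  shows "fps_conv_radius (cF oo fps_X ^ d) \<ge> 1"
    "eval_fps (cF oo fps_X ^ d) z = eval_fps cF (z ^ d)"
proof -
  show "fps_conv_radius (cF oo fps_X ^ d) \<ge> 1"
    using abs_nth_F_le_1 assms(2)
    by (intro fps_conv_radius_ge_1) (simp add: cF_def fps_nth_compose_X_power)
  have "norm (z ^ d) < 1"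
    using assms by (simp add: norm_power power_less_one_iff)
  then have "ereal (norm (z ^ d)) < fps_conv_radius cF"
    by (intro less_le_trans[OF _ conv_radius_cF]) simp
  then have "(\<lambda>n. fps_nth cF n * (z ^ d) ^ n) sums eval_fps cF (z ^ d)"
    by (rule sums_eval_fps)
  also have "(\<lambda>n. fps_nth cF n * (z ^ d) ^ n) = (\<lambda>n. fps_nth (cF oo fps_X ^ d) (d * n) * z ^ (d * n))"
    using assms by (simp add: fps_nth_compose_X_power power_mult)
  finally have "(\<lambda>n. fps_nth (cF oo fps_X ^ d) n * z ^ n) sums eval_fps cF (z ^ d)"
    by (subst (asm) sums_mono_reindex)
       (use assms in \<open>auto simp: strict_mono_def fps_nth_compose_X_power\<close>)
  then show "eval_fps (cF oo fps_X ^ d) z = eval_fps cF (z ^ d)"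
    by (simp add: eval_fps_def sums_iff)
qed

lemma cF_eq: "cF = (1 + fps_X + fps_X ^ 2) * (cF oo fps_X ^ 4) - fps_X ^ 4 * (cF oo fps_X ^ 16)"
proof (rule fps_ext)
  fix n
  have "fps_nth cF n = of_int (fps_nth F n)" by (simp add: cF_def)
  also have "\<dots> = fps_nth ((cF oo fps_X ^ 4) + fps_X ^ 1 * (cF oo fps_X ^ 4)
          + fps_X ^ 2 * (cF oo fps_X ^ 4) - fps_X ^ 4 * (cF oo fps_X ^ 16)) n"
    by (subst nth_F, simp only: fps_add_nth fps_sub_nth fps_X_power_mult_nth)
       (auto simp: fps_nth_compose_X_power cF_def)
  finally show "fps_nth cF n = fps_nth ((1 + fps_X + fps_X ^ 2) * (cF oo fps_X ^ 4)
      - fps_X ^ 4 * (cF oo fps_X ^ 16)) n"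
    by (simp add: algebra_simps)
qed

lemma eval_cF_eq:
  assumes "norm z < 1"
  shows "eval_fps cF z = (1 + z + z ^ 2) * eval_fps cF (z ^ 4) - z ^ 4 * eval_fps cF (z ^ 16)"
proof -
  have r: "ereal (norm z) < fps_conv_radius (cF oo fps_X ^ 4)"
    "ereal (norm z) < fps_conv_radius (cF oo fps_X ^ 16)"
    by (rule less_le_trans[OF _ eval_cF_compose_power(1)[OF assms]], use assms in simp_all)+
  have p: "fps_conv_radius (1 + fps_X + fps_X ^ 2 :: complex fps) = \<infinity>"
    using fps_conv_radius_add[of "1 + fps_X :: complex fps" "fps_X ^ 2"]
      fps_conv_radius_add[of "1 :: complex fps" fps_X] by simp
  have "eval_fps cF z = eval_fps ((1 + fps_X + fps_X ^ 2) * (cF oo fps_X ^ 4)) z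
      - eval_fps (fps_X ^ 4 * (cF oo fps_X ^ 16)) z"
    by (subst cF_eq, rule eval_fps_diff)
       (use r p in \<open>auto intro!: less_le_trans[OF _ fps_conv_radius_mult]\<close>)
  also have "\<dots> = (1 + z + z ^ 2) * eval_fps (cF oo fps_X ^ 4) z - z ^ 4 * eval_fps (cF oo fps_X ^ 16) z"
    using r p fps_conv_radius_add[of "1 :: complex fps" fps_X]
    by (simp add: eval_fps_mult eval_fps_add)
  finally show ?thesis using assms by (simp add: eval_cF_compose_power)
qed

lemma eval_cF_of_real:
  assumes "\<bar>x\<bar> < 1"
  shows "eval_fps cF (of_real x) = of_real (eval_fps (real_fps F) x)"
proof -
  have "(\<lambda>n. fps_nth (real_fps F) n * x ^ n) sums eval_fps (real_fps F) x"
    using assms by (intro sums_eval_fps) (auto intro!: less_le_trans[OF _ conv_radius_real_F])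
  from sums_of_real[OF this, where ?'a = complex] show ?thesis
    by (simp add: eval_fps_def cF_def real_fps_def sums_iff)
qed

lemma holomorphic_eval_cF: "eval_fps cF holomorphic_on ball 0 1"
  by (intro holomorphic_intros) (auto intro!: less_le_trans[OF _ conv_radius_cF])

lemma eval_real_F_mono:
  assumes "0 \<le> x" "x \<le> y" "y < 1"
  shows "eval_fps (real_fps F) x \<le> eval_fps (real_fps F) y"
proof -
  have s: "summable (\<lambda>n. fps_nth (real_fps F) n * x ^ n)" if "\<bar>x\<bar> < 1" for x
    using that by (intro summable_fps) (auto intro!: less_le_trans[OF _ conv_radius_real_F])
  have "fps_nth (real_fps F) n \<ge> 0" for n
    using nth_F_01[of n] by (auto simp: real_fps_def)
  then show ?thesis unfolding eval_fps_def
    using assms by (intro suminf_le s mult_left_mono power_mono) auto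
qed

lemma eval_real_F_ge_1: "0 \<le> x \<Longrightarrow> x < 1 \<Longrightarrow> eval_fps (real_fps F) x \<ge> 1"
  using eval_real_F_mono[of 0 x] F0 by (simp add: eval_fps_at_0 real_fps_def)

section \<open>Rescaled values and their holomorphic limit\<close>

definition b :: "nat \<Rightarrow> complex \<Rightarrow> complex" where
  "b n t = of_real (beta ^ n) * eval_fps cF (exp (- (t / 4 ^ n)))"

lemma norm_exp_less_1:
  assumes "Re t > 0"
  shows "norm (exp (- (t / 4 ^ n))) < 1"
proof -
  have "t / 4 ^ n = t / of_real (4 ^ n)" by simp
  then have "Re (t / 4 ^ n) = Re t / 4 ^ n" by (simp only: Re_divide_of_real)
  then have "Re (t / 4 ^ n) > 0" using assms by simp
  then show ?thesis by (simp only: norm_exp_eq_Re) simp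
qed

text \<open>The fourth and sixteenth powers of \<open>w (n+2)\<close> are \<open>w (n+1)\<close> and
  \<open>w n\<close>, so the functional equation at \<open>w (n+2)\<close> links three consecutive
  terms.\<close>

lemma b_rec:
  assumes "Re t > 0"
  defines "w \<equiv> (\<lambda>n. exp (- (t / 4 ^ n)))"
  shows "b (n+2) t = of_real beta * (1 + w (n+2) + w (n+2) ^ 2) * b (n+1) t - of_real beta ^ 2 * w (n+2) ^ 4 * b n t"
proof -
  have w: "w n ^ k = exp (of_nat k * (- (t / 4 ^ n)))" for n k
    by (simp only: w_def exp_of_nat_mult)
  have w4: "w (n+2) ^ 4 = w (n+1)" and w16: "w (n+2) ^ 16 = w n"
    unfolding w by (simp_all add: w_def)
  have "norm (w (n+2)) < 1" using norm_exp_less_1[OF assms(1)] by (simp only: w_def)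
  note eq = eval_cF_eq[OF this, unfolded w4 w16]
  have b: "b m t = of_real (beta ^ m) * eval_fps cF (w m)" for m
    by (simp only: b_def w_def)
  show ?thesis unfolding b eq w4 by (simp add: power2_eq_square algebra_simps)
qed

lemma holomorphic_b: "b n holomorphic_on right_half_plane"
proof -
  have "eval_fps cF \<circ> (\<lambda>t. exp (- (t / 4 ^ n))) holomorphic_on right_half_plane"
  proof (rule holomorphic_on_compose_gen[OF _ holomorphic_eval_cF])
    show "(\<lambda>t. exp (- (t / 4 ^ n))) holomorphic_on right_half_plane"
      by (intro holomorphic_intros) auto
    show "(\<lambda>t. exp (- (t / 4 ^ n))) ` right_half_plane \<subseteq> ball 0 1"
      using norm_exp_less_1 by (intro image_subsetI) (simp only: mem_ball_0 mem_Collect_eq)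
  qed
  then have "(\<lambda>t. of_real (beta ^ n) * eval_fps cF (exp (- (t / 4 ^ n)))) holomorphic_on right_half_plane"
    unfolding o_def by (intro holomorphic_on_mult holomorphic_on_const)
  then show ?thesis by (simp only: b_def[abs_def])
qed

text \<open>This is \<open>perturbed_recurrence_bound\<close> applied at each point of
  \<open>S\<close>: compactness makes the initial bound and the constant \<open>K\<close> uniform,
  hence also \<open>B\<close>.\<close>

lemma b_increments:
  assumes "compact S" "S \<subseteq> right_half_plane"
  obtains B where "B \<ge> 0" "\<And>t n. t \<in> S \<Longrightarrow> norm (b (n+1) t - b n t) \<le> B / 4 ^ n"
proof -
  have cont: "continuous_on S (b n)" for n
    using holomorphic_on_imp_continuous_on[OF holomorphic_b] assms(2) continuous_on_subset by blast
  have "bounded (b 0 ` S)" "bounded (b 1 ` S)" "bounded S"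
    using assms cont by (auto intro!: compact_imp_bounded compact_continuous_image)
  then obtain A0 A1 R where A: "\<forall>t\<in>S. norm (b 0 t) \<le> A0" "\<forall>t\<in>S. norm (b 1 t) \<le> A1"
    "\<forall>t\<in>S. norm t \<le> R"
    unfolding bounded_iff by auto
  \<comment> \<open>\<open>\<bar>R\<bar> * exp \<bar>R\<bar> / 4 ^ n\<close> bounds
    \<open>norm (w - 1)\<close>, and 4 covers both \<open>1 + 2\<close> and the exponent of
    \<open>w ^ 4 - 1\<close>. Absolute values keep the constants nonnegative even if
    \<open>S\<close> is empty.\<close>
  define K where "K = 4 * \<bar>R\<bar> * exp \<bar>R\<bar>"
  have "K \<ge> 0" "max \<bar>A0\<bar> \<bar>A1\<bar> \<ge> 0" by (auto simp: K_def)
  from perturbed_recurrence_bound[OF this, where ?'a = complex] obtain B where B: "B \<ge> 0"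
    "\<And>b n. norm (b 0 :: complex) \<le> max \<bar>A0\<bar> \<bar>A1\<bar> \<Longrightarrow> norm (b 1) \<le> max \<bar>A0\<bar> \<bar>A1\<bar> \<Longrightarrow>
       (\<And>n. norm (b (n+2) - b (n+1)) \<le> norm (b (n+1) - b n) / 6 + K / 4 ^ n * (norm (b (n+1)) + norm (b n)))
       \<Longrightarrow> norm (b (n+1) - b n) \<le> B / 4 ^ n" by metis
  have "norm (b (n+1) t - b n t) \<le> B / 4 ^ n" if t: "t \<in> S" for t n
  proof (rule B(2))
    show "norm (b 0 t) \<le> max \<bar>A0\<bar> \<bar>A1\<bar>" "norm (b 1 t) \<le> max \<bar>A0\<bar> \<bar>A1\<bar>"
      using bspec[OF A(1) t] bspec[OF A(2) t] by linarith+
    fix n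
    define w where "w = exp (- (t / 4 ^ (n+2)))"
    have Ret: "Re t > 0" using assms t by auto
    from norm_exp_less_1[OF this] have w1: "norm w \<le> 1" by (simp only: w_def less_imp_le)
    have w_diff: "norm (w - 1) \<le> \<bar>R\<bar> * exp \<bar>R\<bar> / 4 ^ n"
    proof -
      have le: "norm (- (t / 4 ^ (n+2))) \<le> \<bar>R\<bar> / 4 ^ n"
        using bspec[OF A(3) t] by (simp add: norm_divide norm_power field_simps)
      also have "\<bar>R\<bar> / 4 ^ n \<le> \<bar>R\<bar> / 1" by (intro divide_left_mono) auto
      finally have le': "norm (- (t / 4 ^ (n+2))) \<le> \<bar>R\<bar>" by simp
      have "norm (w - 1) \<le> exp (norm (- (t / 4 ^ (n+2)))) * norm (- (t / 4 ^ (n+2)))"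
        using Taylor_exp_field[of "- (t / 4 ^ (n+2))" 0] by (simp add: w_def)
      also have "\<dots> \<le> exp \<bar>R\<bar> * (\<bar>R\<bar> / 4 ^ n)"
        using le le' by (intro mult_mono) auto
      finally show ?thesis by (simp add: mult_ac)
    qed
    have pow: "norm (w ^ m - 1) \<le> real m * norm (w - 1)" for m
      using norm_power_diff[of w 1 m] w1 by simp
    \<comment> \<open>For \<open>w = 1\<close> only the first summand remains:
      \<open>beta ^ 2 = 3 * beta - 1\<close> turns the limiting recurrence into a contraction of
      increments. The other two summands are the perturbation.\<close>
    have "b (n+2) t - b (n+1) t = of_real (beta ^ 2) * (b (n+1) t - b n t)
       + of_real beta * ((w - 1) + (w ^ 2 - 1)) * b (n+1) t - of_real (beta ^ 2) * (w ^ 4 - 1) * b n t"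
    proof -
      have eq: "(of_real beta :: complex) ^ 2 = 3 * of_real beta - 1"
        using arg_cong[OF beta_eq, of complex_of_real] by simp
      show ?thesis unfolding b_rec[OF Ret] w_def[symmetric] of_real_power eq
        by (simp add: algebra_simps)
    qed
    also have "norm \<dots> \<le> norm (of_real (beta ^ 2) * (b (n+1) t - b n t))
       + norm (of_real beta * ((w - 1) + (w ^ 2 - 1)) * b (n+1) t)
       + norm (of_real (beta ^ 2) * (w ^ 4 - 1) * b n t)"
      by (meson norm_triangle_ineq4 norm_triangle_ineq order_trans add_right_mono)
    also have "\<dots> \<le> norm (b (n+1) t - b n t) / 6 + K / 4 ^ n * norm (b (n+1) t) + K / 4 ^ n * norm (b n t)"
    proof (intro add_mono)
      have "beta ^ 2 \<le> (2/5) ^ 2" using beta_bounds by (intro power_mono) auto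
      then have b2: "beta ^ 2 \<le> 1 / 6" by (simp add: power2_eq_square)
      then show "norm (of_real (beta ^ 2) * (b (n+1) t - b n t)) \<le> norm (b (n+1) t - b n t) / 6"
        using mult_right_mono[OF b2, of "norm (b (n+1) t - b n t)"] by (simp add: norm_mult norm_power)
      have "norm ((w - 1) + (w ^ 2 - 1)) \<le> 3 * norm (w - 1)"
        using norm_triangle_ineq[of "w - 1" "w ^ 2 - 1"] pow[of 2] by simp
      also have "\<dots> \<le> 4 * norm (w - 1)" by simp
      also have "\<dots> \<le> K / 4 ^ n" using w_diff by (simp add: K_def)
      finally have "beta * norm ((w - 1) + (w ^ 2 - 1)) \<le> 1 * (K / 4 ^ n)"
        using beta_bounds by (intro mult_mono) auto
      then show "norm (of_real beta * ((w - 1) + (w ^ 2 - 1)) * b (n+1) t) \<le> K / 4 ^ n * norm (b (n+1) t)"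
        unfolding norm_mult norm_of_real using beta_bounds by (intro mult_right_mono) auto
      have "norm (w ^ 4 - 1) \<le> K / 4 ^ n" using w_diff pow[of 4] by (simp add: K_def)
      then have "beta ^ 2 * norm (w ^ 4 - 1) \<le> 1 * (K / 4 ^ n)"
        using b2 by (intro mult_mono) auto
      then show "norm (of_real (beta ^ 2) * (w ^ 4 - 1) * b n t) \<le> K / 4 ^ n * norm (b n t)"
        unfolding norm_mult norm_of_real using beta_bounds by (intro mult_right_mono) auto
    qed
    finally show "norm (b (n+2) t - b (n+1) t)
        \<le> norm (b (n+1) t - b n t) / 6 + K / 4 ^ n * (norm (b (n+1) t) + norm (b n t))"
      by (simp add: algebra_simps)
  qed
  with B(1) show ?thesis by (rule that)
qed

definition Phi :: "complex \<Rightarrow> complex" where "Phi t = lim (\<lambda>n. b n t)"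

lemma Phi_approx:
  assumes "compact S" "S \<subseteq> right_half_plane"
  obtains B where "\<And>t n. t \<in> S \<Longrightarrow> norm (Phi t - b n t) \<le> B / 4 ^ n"
proof -
  obtain B where B: "B \<ge> 0" "\<And>t n. t \<in> S \<Longrightarrow> norm (b (n+1) t - b n t) \<le> B / 4 ^ n"
    using b_increments[OF assms] by metis
  show ?thesis
    by (rule that[of "2 * B"], unfold Phi_def, rule geometric_increments_limit, rule B)
qed

lemma b_tendsto_Phi:
  assumes "Re t > 0"
  shows "(\<lambda>n. b n t) \<longlonglongrightarrow> Phi t"
proof -
  have t: "compact {t}" "{t} \<subseteq> right_half_plane" using assms by auto
  obtain B where B: "B \<ge> 0" "\<And>s n. s \<in> {t} \<Longrightarrow> norm (b (n+1) s - b n s) \<le> B / 4 ^ n"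
    using b_increments[OF t] by metis
  from geometric_increments_limit(1)[of "\<lambda>n. b n t", OF B(2)] show ?thesis
    by (simp add: Phi_def convergent_LIMSEQ_iff)
qed

lemma holomorphic_Phi: "Phi holomorphic_on right_half_plane"
proof (rule holomorphic_uniform_sequence[where f = b])
  show op: "open right_half_plane" by (rule open_halfspace_Re_gt)
  show "b n holomorphic_on right_half_plane" for n by (rule holomorphic_b)
  fix t assume "t \<in> right_half_plane"
  then obtain d where d: "d > 0" "cball t d \<subseteq> right_half_plane"
    using op open_contains_cball by blast
  obtain B where B: "\<And>s n. s \<in> cball t d \<Longrightarrow> norm (Phi s - b n s) \<le> B / 4 ^ n"
    using Phi_approx[OF compact_cball d(2)] by blast
  have "uniform_limit (cball t d) b Phi sequentially"
  proof (rule uniform_limitI)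
    fix e :: real assume "e > 0"
    have "(\<lambda>n. B / 4 ^ n) \<longlonglongrightarrow> 0"
      by (rule LIMSEQ_divide_realpow_zero) simp
    from order_tendstoD(2)[OF this \<open>e > 0\<close>]
    show "\<forall>\<^sub>F n in sequentially. \<forall>s\<in>cball t d. dist (b n s) (Phi s) < e"
    proof eventually_elim
      case (elim n)
      show ?case
      proof
        fix s assume s: "s \<in> cball t d"
        show "dist (b n s) (Phi s) < e"
          using le_less_trans[OF B[OF s] elim] by (simp add: dist_norm norm_minus_commute)
      qed
    qed
  qed
  with d show "\<exists>d>0. cball t d \<subseteq> right_half_plane \<and> uniform_limit (cball t d) b Phi sequentially"
    by blast
qed

lemma b_divide_4: "b n (t / 4) = b (Suc n) t / of_real beta"
  using beta_bounds by (simp add: b_def mult.commute)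

text \<open>Dividing the argument by 4 shifts the index of \<open>b\<close> by one at the cost of a
  factor \<open>beta\<close>, and the limit ignores the shift.\<close>

lemma Phi_divide_4:
  assumes "Re t > 0"
  shows "Phi (t / 4) = Phi t / of_real beta"
proof (rule LIMSEQ_unique)
  show "(\<lambda>n. b n (t / 4)) \<longlonglongrightarrow> Phi (t / 4)" using assms by (intro b_tendsto_Phi) simp
  show "(\<lambda>n. b n (t / 4)) \<longlonglongrightarrow> Phi t / of_real beta"
    unfolding b_divide_4 using beta_bounds
    by (intro tendsto_divide LIMSEQ_Suc[OF b_tendsto_Phi] assms) auto
qed

section \<open>Restriction to the real axis and positivity of the limit\<close>

abbreviation f :: "real \<Rightarrow> real" where "f \<equiv> eval_fps (real_fps F)"

lemma f_eq:
  assumes "0 \<le> x" "x < 1"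
  shows "f x = (1 + x + x ^ 2) * f (x ^ 4) - x ^ 4 * f (x ^ 16)"
proof -
  have x: "\<bar>x\<bar> < 1" "\<bar>x ^ 4\<bar> < 1" "\<bar>x ^ 16\<bar> < 1"
    using assms by (auto simp: power_less_one_iff)
  have "eval_fps cF (of_real x) = (1 + of_real x + of_real x ^ 2) * eval_fps cF (of_real (x ^ 4))
      - of_real x ^ 4 * eval_fps cF (of_real (x ^ 16))"
    using eval_cF_eq[of "of_real x"] x by simp
  then have "complex_of_real (f x) = of_real ((1 + x + x ^ 2) * f (x ^ 4) - x ^ 4 * f (x ^ 16))"
    unfolding eval_cF_of_real[OF x(1)] eval_cF_of_real[OF x(2)] eval_cF_of_real[OF x(3)] by simp
  then show ?thesis by (simp only: of_real_eq_iff)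
qed

definition rb :: "nat \<Rightarrow> real \<Rightarrow> real" where "rb n t = beta ^ n * f (exp (- (t / 4 ^ n)))"

lemma b_of_real: "t > 0 \<Longrightarrow> b n (of_real t) = of_real (rb n t)"
proof -
  assume t: "t > 0"
  have "exp (- (complex_of_real t / 4 ^ n)) = of_real (exp (- (t / 4 ^ n)))"
    by (simp flip: exp_of_real)
  moreover have "\<bar>exp (- (t / 4 ^ n))\<bar> < 1" using t by simp
  ultimately show ?thesis by (simp only: b_def rb_def eval_cF_of_real of_real_mult)
qed

text \<open>\<open>Re\<close> loses nothing for positive \<open>t\<close>, since \<open>Phi\<close>
  is real there (\<open>Phi_of_real\<close>).\<close>

definition phi :: "real \<Rightarrow> real" where "phi t = Re (Phi (of_real t))"

lemma rb_tendsto_phi: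
  assumes "t > 0"
  shows "(\<lambda>n. rb n t) \<longlonglongrightarrow> phi t"
  using tendsto_Re[OF b_tendsto_Phi[of "of_real t"]] assms by (simp add: b_of_real phi_def)

lemma Phi_of_real:
  assumes "t > 0"
  shows "Phi (of_real t) = of_real (phi t)"
proof (rule LIMSEQ_unique)
  show "(\<lambda>n. b n (of_real t)) \<longlonglongrightarrow> Phi (of_real t)" using assms by (intro b_tendsto_Phi) simp
  show "(\<lambda>n. b n (of_real t)) \<longlonglongrightarrow> of_real (phi t)"
    using tendsto_of_real[OF rb_tendsto_phi[OF assms]] assms by (simp add: b_of_real)
qed

lemma phi_divide_4_power:
  assumes "t > 0"
  shows "phi (t / 4 ^ n) = phi t / beta ^ n"
proof (induction n)
  case (Suc n)
  have "Phi (of_real (t / 4 ^ n) / 4) = Phi (of_real (t / 4 ^ n)) / of_real beta"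
    using assms by (intro Phi_divide_4) (simp flip: of_real_power)
  also have "of_real (t / 4 ^ n) / 4 = complex_of_real (t / 4 ^ Suc n)" by simp
  finally have "phi (t / 4 ^ Suc n) = phi (t / 4 ^ n) / beta"
    by (simp only: phi_def Re_divide_of_real)
  then show ?case using Suc by simp
qed simp

text \<open>The limiting recurrence has the characteristic roots \<open>beta\<close> and \<open>1 / beta\<close>; since \<open>f\<close> is increasing,
  the component of \<open>f (exp (- (t / 4 ^ n)))\<close> along the growing solution cannot vanish.\<close>
lemma phi_pos_le_1:
  assumes t: "0 < t" "t \<le> 1"
  shows "phi t > 0"
proof -
  define w where "w n = exp (- (t / 4 ^ n))" for n
  define a where "a n = f (w n)" for n
  have w01: "0 < w n" "w n < 1" for n using t by (auto simp: w_def)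
  have wpow: "w n ^ k = exp (of_nat k * (- (t / 4 ^ n)))" for n k
    by (simp only: w_def exp_of_nat_mult)
  have w4: "w (Suc n) ^ 4 = w n" and w16: "w (Suc (Suc n)) ^ 16 = w n" for n
    unfolding wpow by (simp_all add: w_def)
  have rec: "a (Suc (Suc n)) = (1 + w (Suc (Suc n)) + w (Suc (Suc n)) ^ 2) * a (Suc n) - w (Suc n) * a n" for n
    using f_eq[of "w (Suc (Suc n))"] w01[of "Suc (Suc n)"] by (simp only: a_def w4 w16)
  have a1: "a n \<ge> 1" for n unfolding a_def using w01[of n] by (intro eval_real_F_ge_1) auto
  have a_mono: "a n \<le> a (Suc n)" for n
    unfolding a_def using w01 t by (intro eval_real_F_mono) (auto simp: w_def field_simps)
  \<comment> \<open>\<open>a (Suc n) - beta * a n\<close> annihilates the decaying solution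
    \<open>beta ^ n\<close> of the limiting recurrence; after multiplication by
    \<open>beta ^ n\<close> the contribution of the growing solution is constant in
    \<open>n\<close>.\<close>
  define c where "c n = beta ^ n * (a (Suc n) - beta * a n)" for n
  \<comment> \<open>Here monotonicity of \<open>f\<close> enters, through \<open>a_mono\<close>; it
    keeps \<open>c\<close> away from 0.\<close>
  have lower: "(3 / 5) * a (Suc n) \<le> a (Suc n) - beta * a n" for n
  proof -
    have "beta * a n \<le> (2 / 5) * a (Suc n)"
      using beta_bounds a_mono[of n] a1[of n] by (intro mult_mono) auto
    then show ?thesis by simp
  qed
  have c_pos: "c n > 0" for n
    unfolding c_def using lower[of n] a1[of "Suc n"] beta_bounds by (intro mult_pos_pos) auto
  \<comment> \<open>The coefficient of \<open>a (Suc n)\<close> falls short of 3 by at most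
    \<open>3 * s\<close> with \<open>s = t / 4 ^ (n + 2)\<close>. By \<open>lower\<close> this costs
    at most the fraction \<open>2 * s\<close> of \<open>c n\<close>.\<close>
  have c_step: "c n * (1 - 2 / 4 ^ (n + 2)) \<le> c (Suc n)" for n
  proof -
    define s where "s = t / 4 ^ (n + 2)"
    have s: "s \<ge> 0" "s \<le> 1 / 4 ^ (n + 2)" using t by (auto simp: s_def divide_right_mono)
    have ws: "w (Suc (Suc n)) \<ge> 1 - s" "w (Suc (Suc n)) ^ 2 \<ge> 1 - 2 * s"
      using exp_ge_add_one_self[of "- s"] exp_ge_add_one_self[of "-2 * s"]
      by (auto simp: w_def s_def simp flip: exp_of_nat_mult)
    have "(3 - 3 * s) * a (Suc n) \<le> (1 + w (Suc (Suc n)) + w (Suc (Suc n)) ^ 2) * a (Suc n)"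
      using ws a1[of "Suc n"] by (intro mult_right_mono) auto
    moreover have "w (Suc n) * a n \<le> 1 * a n"
      using w01[of "Suc n"] a1[of n] by (intro mult_right_mono) auto
    ultimately have "(3 - 3 * s) * a (Suc n) - a n - beta * a (Suc n) \<le> a (Suc (Suc n)) - beta * a (Suc n)"
      unfolding rec[of n] by linarith
    then have "beta * ((3 - 3 * s) * a (Suc n) - a n - beta * a (Suc n)) \<le> beta * (a (Suc (Suc n)) - beta * a (Suc n))"
      using beta_bounds by (intro mult_left_mono) auto
    moreover have "beta * ((3 - 3 * s) * a (Suc n) - a n - beta * a (Suc n))
        = (a (Suc n) - beta * a n) - 3 * s * beta * a (Suc n)"
    proof -
      have "beta * ((3 - 3 * s) * a (Suc n) - a n - beta * a (Suc n))
          = (3 * beta - beta ^ 2) * a (Suc n) - beta * a n - 3 * s * beta * a (Suc n)"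
        by (simp add: algebra_simps power2_eq_square)
      then show ?thesis using beta_eq by simp
    qed
    moreover have "3 * s * beta * a (Suc n) \<le> 2 * s * (a (Suc n) - beta * a n)"
    proof -
      have "3 * beta * a (Suc n) \<le> (6 / 5) * a (Suc n)"
        using beta_bounds a1[of "Suc n"] by (intro mult_right_mono) auto
      also have "\<dots> \<le> 2 * (a (Suc n) - beta * a n)" using lower[of n] by (simp add: algebra_simps)
      finally have "s * (3 * beta * a (Suc n)) \<le> s * (2 * (a (Suc n) - beta * a n))"
        using s by (intro mult_left_mono) auto
      then show ?thesis by (simp only: mult_ac)
    qed
    moreover have "(a (Suc n) - beta * a n) * (1 - 2 * s)
        = (a (Suc n) - beta * a n) - 2 * s * (a (Suc n) - beta * a n)"
      by (simp only: right_diff_distrib mult_1_right mult_ac)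
    ultimately have "(a (Suc n) - beta * a n) * (1 - 2 * s) \<le> beta * (a (Suc (Suc n)) - beta * a (Suc n))"
      by linarith
    then have "beta ^ n * ((a (Suc n) - beta * a n) * (1 - 2 * s)) \<le> beta ^ n * (beta * (a (Suc (Suc n)) - beta * a (Suc n)))"
      using beta_bounds by (intro mult_left_mono) auto
    then have "c n * (1 - 2 * s) \<le> c (Suc n)" by (simp add: c_def mult_ac)
    moreover have "c n * (1 - 2 / 4 ^ (n + 2)) \<le> c n * (1 - 2 * s)"
      using s c_pos[of n] by (intro mult_left_mono) auto
    ultimately show ?thesis by linarith
  qed
  \<comment> \<open>The surplus \<open>1 / 4 ^ Suc n\<close> absorbs the loss at each step; the
    bound \<open>1 / 2\<close> alone would not be inductive.\<close>
  have c_lower: "c 0 * (1 / 2 + 1 / 4 ^ Suc n) \<le> c n" for n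
  proof (induction n)
    case 0
    then show ?case using c_pos[of 0] by simp
  next
    case (Suc n)
    define x :: real where "x = 1 / 4 ^ (n + 2)"
    have "x \<le> 1 / 4 ^ 1" unfolding x_def by (intro divide_left_mono power_increasing) auto
    then have x: "0 < x" "x \<le> 1 / 4" by (auto simp: x_def)
    have "x * x \<le> x * (1 / 4)" using x by (intro mult_left_mono) auto
    then have "1 / 2 + x \<le> (1 / 2 + 4 * x) * (1 - 2 * x)" by (simp add: algebra_simps)
    then have "c 0 * (1 / 2 + x) \<le> c 0 * ((1 / 2 + 4 * x) * (1 - 2 * x))"
      using c_pos[of 0] by (intro mult_left_mono) auto
    also have "\<dots> = c 0 * (1 / 2 + 1 / 4 ^ Suc n) * (1 - 2 * x)" by (simp add: x_def)
    also have "\<dots> \<le> c n * (1 - 2 * x)" using Suc x by (intro mult_right_mono) auto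
    also have "\<dots> \<le> c (Suc n)" using c_step[of n] by (simp add: x_def)
    finally show ?case by (simp add: x_def)
  qed
  have c_rb: "c n = rb (Suc n) t / beta - beta * rb n t" for n
    using beta_bounds by (simp add: c_def rb_def a_def w_def algebra_simps)
  \<comment> \<open>The limit is \<open>phi t\<close> times the positive number
    \<open>1 / beta - beta\<close>, so the lower bound on \<open>c\<close> passes to
    \<open>phi t\<close>.\<close>
  have "(\<lambda>n. c n) \<longlonglongrightarrow> phi t / beta - beta * phi t"
    unfolding c_rb using beta_bounds t
    by (intro tendsto_intros LIMSEQ_Suc[OF rb_tendsto_phi] rb_tendsto_phi) auto
  moreover have "c 0 / 2 \<le> c n" for n
  proof -
    have "c 0 * (1 / 2) \<le> c 0 * (1 / 2 + 1 / 4 ^ Suc n)"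
      using c_pos[of 0] by (intro mult_left_mono) auto
    then show ?thesis using c_lower[of n] by simp
  qed
  ultimately have "c 0 / 2 \<le> phi t / beta - beta * phi t"
    by (intro LIMSEQ_le_const) auto
  then have "0 < phi t * (1 / beta - beta)" using c_pos[of 0] by (simp add: algebra_simps)
  moreover have "1 / beta = 3 - beta"
    using beta_eq beta_bounds by (simp add: field_simps power2_eq_square)
  then have "1 / beta - beta > 0" using beta_bounds by simp
  ultimately show ?thesis by (simp add: zero_less_mult_iff)
qed

text \<open>Scaling by a power of 4 reduces every positive \<open>t\<close> to the case
  \<open>t \<le> 1\<close>.\<close>

lemma phi_pos:
  assumes "t > 0"
  shows "phi t > 0"
proof -
  obtain k where "t < 4 ^ k" using real_arch_pow[of 4 t] by auto
  then have "phi (t / 4 ^ k) > 0" using assms by (intro phi_pos_le_1) (auto simp: field_simps)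
  then show ?thesis using phi_divide_4_power[OF assms, of k] beta_bounds
    by (simp add: zero_less_divide_iff)
qed

lemma continuous_phi: "continuous_on {0<..} phi"
proof -
  have "continuous_on right_half_plane Phi"
    by (rule holomorphic_on_imp_continuous_on[OF holomorphic_Phi])
  then have "continuous_on {0<..} (\<lambda>t::real. Phi (of_real t))"
    by (rule continuous_on_compose2) (auto intro!: continuous_intros)
  then show ?thesis unfolding phi_def[abs_def] by (intro continuous_intros)
qed

section \<open>Relative error of the approximation by \<open>phi\<close>\<close>

text \<open>Write \<open>t = s / 4 ^ m\<close> with \<open>s\<close> in \<open>[1, 4]\<close>. The
  powers of \<open>beta\<close> cancel and the quotient becomes \<open>rb m s / phi s\<close>; the
  error \<open>B / 4 ^ m\<close> is at most \<open>B * t\<close> because \<open>s \<ge> 1\<close>,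
  and \<open>phi\<close> has a positive minimum on \<open>[1, 4]\<close>.\<close>

lemma f_over_phi:
  obtains K where "K \<ge> 0" "\<And>t. 0 < t \<Longrightarrow> t \<le> 1 \<Longrightarrow> \<bar>f (exp (- t)) / phi t - 1\<bar> \<le> K * t"
proof -
  have comp: "compact (of_real ` {1..4::real} :: complex set)"
    by (intro compact_continuous_image continuous_intros) auto
  have sub: "(of_real ` {1..4::real}) \<subseteq> right_half_plane" by auto
  obtain B where B: "\<And>t n. t \<in> of_real ` {1..4} \<Longrightarrow> norm (Phi t - b n t) \<le> B / 4 ^ n"
    using Phi_approx[OF comp sub] by metis
  have B': "\<bar>phi s - rb n s\<bar> \<le> B / 4 ^ n" if "s \<in> {1..4}" for s n
  proof -
    have "norm (complex_of_real (phi s - rb n s)) \<le> B / 4 ^ n"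
      using B[of "of_real s" n] that by (auto simp: Phi_of_real b_of_real)
    then show ?thesis by (simp only: norm_of_real)
  qed
  have B0: "B \<ge> 0" using order_trans[OF abs_ge_zero B'[of 1 0]] by simp
  have "continuous_on {1..4} phi" by (rule continuous_on_subset[OF continuous_phi]) auto
  then obtain s0 where s0: "s0 \<in> {1..4}" "\<And>s. s \<in> {1..4} \<Longrightarrow> phi s0 \<le> phi s"
    using continuous_attains_inf[of "{1..4}" phi] by auto
  have d0: "phi s0 > 0" using s0 by (intro phi_pos) auto
  show ?thesis
  proof (rule that[of "B / phi s0"])
    show "B / phi s0 \<ge> 0" using B0 d0 by simp
    fix t :: real assume t: "0 < t" "t \<le> 1"
    obtain s m where s: "s \<in> {1..4}" "t = s / 4 ^ m"
      using scale_to_fundamental_interval[OF t] by metis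
    have ps: "phi s > 0" using s by (intro phi_pos) auto
    have "f (exp (- t)) / phi t = rb m s / phi s"
      using phi_divide_4_power[of s m] s beta_bounds by (simp add: rb_def)
    also have "\<dots> - 1 = (rb m s - phi s) / phi s" using ps by (simp add: field_simps)
    finally have "\<bar>f (exp (- t)) / phi t - 1\<bar> = \<bar>phi s - rb m s\<bar> / phi s"
      using ps by (simp add: abs_minus_commute)
    also have "\<dots> \<le> (B / 4 ^ m) / phi s0"
      using B'[OF s(1), of m] s0(2)[OF s(1)] d0 by (intro frac_le) auto
    also have "\<dots> \<le> (B * t) / phi s0"
    proof -
      have "B * (1 / 4 ^ m) \<le> B * t" using s B0 by (intro mult_left_mono) (auto simp: divide_right_mono)
      then show ?thesis using d0 by (intro divide_right_mono) auto
    qed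
    finally show "\<bar>f (exp (- t)) / phi t - 1\<bar> \<le> B / phi s0 * t" by simp
  qed
qed

section \<open>The scale-invariant function: bounds and analyticity\<close>

definition psi :: "real \<Rightarrow> real \<Rightarrow> real" where "psi \<alpha> t = t powr \<alpha> * phi t"

lemma psi_pos: "t > 0 \<Longrightarrow> psi \<alpha> t > 0"
  by (simp add: psi_def phi_pos)

text \<open>The condition on \<alpha> says that the power of \<open>t\<close> loses a factor
  \<open>beta\<close> per division by 4, exactly what \<open>phi\<close> gains.\<close>

lemma psi_divide_4_power:
  assumes "t > 0" "4 powr \<alpha> = 1 / beta"
  shows "psi \<alpha> (t / 4 ^ n) = psi \<alpha> t"
proof -
  have "((4::real) ^ n) powr \<alpha> = (4 powr \<alpha>) ^ n"
    by (simp add: powr_powr mult.commute flip: powr_realpow)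
  then have "(t / 4 ^ n) powr \<alpha> = t powr \<alpha> * beta ^ n"
    using assms by (simp add: powr_divide power_one_over)
  then show ?thesis using assms beta_bounds by (simp add: psi_def phi_divide_4_power)
qed

lemma psi_bounds:
  assumes "4 powr \<alpha> = 1 / beta"
  obtains l u where "l > 0" "\<And>t. t > 0 \<Longrightarrow> l \<le> psi \<alpha> t \<and> psi \<alpha> t \<le> u"
proof -
  have "continuous_on {1..4} phi" by (rule continuous_on_subset[OF continuous_phi]) auto
  then have cont: "continuous_on {1..4} (psi \<alpha>)"
    unfolding psi_def by (intro continuous_intros) auto
  obtain s0 where s0: "s0 \<in> {1..4}" "\<forall>s\<in>{1..4}. psi \<alpha> s0 \<le> psi \<alpha> s"
    using continuous_attains_inf[OF _ _ cont] by auto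
  obtain s1 where s1: "s1 \<in> {1..4}" "\<forall>s\<in>{1..4}. psi \<alpha> s \<le> psi \<alpha> s1"
    using continuous_attains_sup[OF _ _ cont] by auto
  have "\<exists>s\<in>{1..4}. psi \<alpha> t = psi \<alpha> s" if t0: "t > 0" for t
  proof (cases "t \<le> 1")
    case True
    obtain s m where s: "s \<in> {1..4}" "t = s / 4 ^ m"
      using scale_to_fundamental_interval[OF t0 True] by metis
    then show ?thesis using psi_divide_4_power[OF _ assms, of s m] by auto
  next
    case False
    \<comment> \<open>Scaling \<open>1 / t\<close> gives \<open>t = 4 ^ m / s\<close>; one further
      factor 4 leads to the representative \<open>4 / s\<close>, again in
      \<open>[1, 4]\<close>.\<close>
    then have "0 < 1 / t" "1 / t \<le> 1" by auto
    from scale_to_fundamental_interval[OF this] obtain s m where s: "s \<in> {1..4}" "1 / t = s / 4 ^ m"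
      by metis
    have ts: "t / 4 ^ m = (4 / s) / 4 ^ 1" using s t0 by (simp add: field_simps)
    have "psi \<alpha> t = psi \<alpha> (4 / s)"
      using psi_divide_4_power[OF t0 assms, of m] psi_divide_4_power[of "4 / s" \<alpha> 1] assms s
      unfolding ts by simp
    then show ?thesis using s by (intro bexI[of _ "4 / s"]) (auto simp: field_simps)
  qed
  then have "psi \<alpha> s0 \<le> psi \<alpha> t \<and> psi \<alpha> t \<le> psi \<alpha> s1" if "t > 0" for t
    using that s0 s1 by metis
  moreover have "psi \<alpha> s0 > 0" using s0 by (intro psi_pos) auto
  ultimately show ?thesis using that by blast
qed

text \<open>Near each \<open>x\<close> the function is the real part of a holomorphic
  \<open>H\<close> on the real axis, so the Taylor series of \<open>H\<close> supplies the
  expansion.\<close>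

lemma psi_neg_ln_real_analytic: "(\<lambda>z. psi \<alpha> (- ln z)) real_analytic_on {0<..<1}"
  unfolding real_analytic_on_def
proof
  fix x :: real assume x: "x \<in> {0<..<1}"
  \<comment> \<open>\<open>Re w > 0\<close> avoids the branch cut of \<open>Ln\<close>;
    \<open>norm w < 1\<close> puts \<open>- Ln w\<close> in the right half-plane, where
    \<open>Phi\<close> and the principal power are holomorphic.\<close>
  define S where "S = {w. Re w > 0} \<inter> ball 0 1"
  define H where "H w = (- Ln w) powr of_real \<alpha> * Phi (- Ln w)" for w
  have S: "open S" "of_real x \<in> S"
    using x by (auto simp: S_def open_halfspace_Re_gt)
  have S_nonpos: "w \<notin> \<real>\<^sub>\<le>\<^sub>0" if "w \<in> S" for w
    using that by (auto simp: S_def complex_nonpos_Reals_iff)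
  have Re: "Re (- Ln w) > 0" if "w \<in> S" for w
  proof -
    have "w \<noteq> 0" "norm w < 1" using that by (auto simp: S_def)
    then show ?thesis by simp
  qed
  have "Phi \<circ> (\<lambda>w. - Ln w) holomorphic_on S"
    by (rule holomorphic_on_compose_gen[OF _ holomorphic_Phi])
       (use S_nonpos Re in \<open>auto intro!: holomorphic_intros\<close>)
  moreover have "- Ln w \<notin> \<real>\<^sub>\<le>\<^sub>0" if "w \<in> S" for w
    using Re[OF that] by (auto simp: complex_nonpos_Reals_iff)
  then have "(\<lambda>w. (- Ln w) powr of_real \<alpha>) holomorphic_on S"
    using S_nonpos by (intro holomorphic_intros) auto
  ultimately have "H holomorphic_on S"
    unfolding H_def o_def by (intro holomorphic_on_mult)
  then have "H analytic_on {of_real x}"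
    using S analytic_at by blast
  from has_fps_expansion_Re[OF analytic_at_imp_has_fps_expansion[OF this]]
  obtain p where p: "(\<lambda>u::real. Re (H (of_real x + of_real u))) has_fps_expansion p" by blast
  have H_real: "Re (H (of_real z)) = psi \<alpha> (- ln z)" if "z \<in> {0<..<1}" for z
  proof -
    have t: "- ln z > 0" using that by simp
    have L: "- Ln (of_real z) = of_real (- ln z)" using that by (simp add: Ln_of_real)
    have "H (of_real z) = of_real ((- ln z) powr \<alpha>) * of_real (phi (- ln z))"
      unfolding H_def L using t by (simp only: Phi_of_real powr_of_real less_imp_le)
    then show ?thesis by (simp add: psi_def)
  qed
  have "eventually (\<lambda>u. x + u \<in> {0<..<1}) (nhds 0)"
  proof -
    have "((\<lambda>u. x + u) \<longlongrightarrow> x + 0) (nhds 0)" by (intro tendsto_intros filterlim_ident)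
    then show ?thesis using x by (intro topological_tendstoD) auto
  qed
  then have "eventually (\<lambda>u. Re (H (of_real x + of_real u)) = psi \<alpha> (- ln (x + u))) (nhds 0)"
    by eventually_elim (use H_real in \<open>simp flip: of_real_add\<close>)
  with p have "(\<lambda>u. psi \<alpha> (- ln (x + u))) has_fps_expansion p"
    unfolding has_fps_expansion_def by (auto elim: eventually_elim2)
  then show "\<exists>p. (\<lambda>u. psi \<alpha> (- ln (x + u))) has_fps_expansion p" ..
qed

section \<open>Asymptotics as z tends to 1 from the left\<close>

text \<open>The quotient factors as \<open>f z / phi t\<close>, within \<open>O(t)\<close> of 1 by
  \<open>f_over_phi\<close>, times the power of \<open>(1 - z) / t\<close>, within
  \<open>1 - z\<close> of 1.\<close>

lemma f_asymptotics:
  assumes "0 \<le> \<alpha>" "\<alpha> \<le> 1"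
  shows "(\<lambda>z. f z * (1 - z) powr \<alpha> / psi \<alpha> (- ln z) - 1) \<in> O[at_left 1](\<lambda>z. 1 - z)"
proof -
  obtain K where K: "K \<ge> 0" "\<And>t. 0 < t \<Longrightarrow> t \<le> 1 \<Longrightarrow> \<bar>f (exp (- t)) / phi t - 1\<bar> \<le> K * t"
    using f_over_phi by metis
  \<comment> \<open>\<open>z > 1 / 2\<close> gives \<open>t \<le> 2 * (1 - z) \<le> 1\<close>,
    whence \<open>2 * K\<close> from the first factor; the summand 1 comes from the second.\<close>
  have "\<bar>f z * (1 - z) powr \<alpha> / psi \<alpha> (- ln z) - 1\<bar> \<le> (2 * K + 1) * (1 - z)"
    if z: "1 / 2 < z" "z < 1" for z
  proof -
    define t where "t = - ln z"
    define q where "q = ((1 - z) / t) powr \<alpha>"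
    define y where "y = f z / phi t - 1"
    have t: "t > 0" "z = exp (- t)" using z by (auto simp: t_def)
    have "t \<le> 1 / z - 1" using ln_le_minus_one[of "1 / z"] z by (simp add: t_def ln_div)
    also have "\<dots> = (1 - z) / z" using z by (simp add: field_simps)
    also have "\<dots> \<le> (1 - z) / (1 / 2)" using z by (intro divide_left_mono) auto
    finally have t2: "t \<le> 2 * (1 - z)" by simp
    have "t \<le> 1" using t2 z by simp
    then have "\<bar>y\<bar> \<le> K * t" using K(2)[of t] t by (simp add: y_def)
    also have "\<dots> \<le> K * (2 * (1 - z))" using K(1) t2 by (intro mult_left_mono)
    finally have y: "\<bar>y\<bar> \<le> 2 * K * (1 - z)" by (simp only: mult_ac)
    have q: "z \<le> q" "q \<le> 1"
      using powr_quotient_neg_ln_bounds[of z \<alpha>] z assms by (auto simp: q_def t_def)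
    have "f z * (1 - z) powr \<alpha> / psi \<alpha> t = (1 + y) * q"
      using z t by (simp add: psi_def y_def q_def powr_divide)
    also have "\<dots> - 1 = y * q - (1 - q)" by (simp add: algebra_simps)
    also have "\<bar>\<dots>\<bar> \<le> \<bar>y * q\<bar> + \<bar>1 - q\<bar>" by (rule abs_triangle_ineq4)
    also have "\<bar>y * q\<bar> \<le> \<bar>y\<bar> * 1" unfolding abs_mult using q z by (intro mult_left_mono) auto
    finally show ?thesis using y q by (simp add: t_def algebra_simps)
  qed
  moreover have "eventually (\<lambda>z::real. z \<in> {1/2<..<1}) (at_left 1)"
    by (rule eventually_at_leftI[of "1/2"]) auto
  ultimately show ?thesis
    by (intro bigoI[where c = "2 * K + 1"]) (auto elim!: eventually_mono)
qed

end

theorem theorem1p3: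
  fixes F :: "int fps" and \<rho> :: real
  assumes F0: "fps_nth F 0 = 1"
    and F_eq: "F = (1 + fps_X + fps_X ^ 2) * (F oo fps_X ^ 4) - fps_X ^ 4 * (F oo fps_X ^ 16)"
    and \<rho>: "\<rho> = (1 + sqrt 5) / 2"
  shows "\<exists>C :: real \<Rightarrow> real.
    (\<forall>z\<in>{0<..<1}. C z > 0) \<and>
    (\<exists>a b. 0 < a \<and> (\<forall>z\<in>{0<..<1}. a \<le> C z \<and> C z \<le> b)) \<and>
    C real_analytic_on {0<..<1} \<and>
    (\<forall>z\<in>{0<..<1}. C z = C (z ^ 4)) \<and>
    (\<exists>E :: real \<Rightarrow> real. E \<in> O[at_left 1](\<lambda>z. 1 - z) \<and>
      (\<forall>\<^sub>F z in at_left 1.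
        eval_fps (real_fps F) z = C z / (1 - z) powr (log 2 \<rho>) * (1 + E z)))"
proof -
  interpret stern_series F by unfold_locales (fact F0, fact F_eq)
  define \<alpha> where "\<alpha> = log 2 \<rho>"
  have "sqrt 5 < 3" "1 < sqrt 5" by (rule real_less_lsqrt, auto)
  then have \<rho>_bounds: "1 < \<rho>" "\<rho> < 2" by (auto simp: \<rho>)
  then have \<alpha>: "0 \<le> \<alpha>" "\<alpha> \<le> 1"
    by (auto simp: \<alpha>_def log_le_iff le_log_iff)
  \<comment> \<open>This fixes the exponent: \<open>4 powr \<alpha>\<close> has to match the growth
    \<open>1 / beta\<close> of \<open>phi\<close> under division by 4.\<close>
  have "(4::real) powr \<alpha> = (2 powr \<alpha>) ^ 2"
    by (simp add: powr_powr powr_realpow power2_eq_square flip: powr_mult)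
  also have "\<dots> = \<rho> ^ 2" using \<rho>_bounds by (simp add: \<alpha>_def)
  also have "\<dots> = 1 / beta"
  proof -
    have "\<rho> ^ 2 * beta = 1" by (simp add: \<rho> beta_def power2_eq_square field_simps)
    then show ?thesis using beta_bounds by (simp add: field_simps)
  qed
  finally have 4: "4 powr \<alpha> = 1 / beta" .
  define C where "C z = psi \<alpha> (- ln z)" for z
  \<comment> \<open>\<open>E\<close> solves the desired equation exactly on all of
    \<open>(0, 1)\<close>, so the asymptotic content lies in its bound alone.\<close>
  define E where "E z = f z * (1 - z) powr \<alpha> / C z - 1" for z
  have C_pos: "C z > 0" if "z \<in> {0<..<1}" for z
    unfolding C_def using that by (intro psi_pos) auto
  have "C z = C (z ^ 4)" if "z \<in> {0<..<1}" for z
    using psi_divide_4_power[of "- ln (z ^ 4)" \<alpha> 1] 4 that by (simp add: C_def ln_realpow)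
  moreover obtain l u where "l > 0" "\<And>t. t > 0 \<Longrightarrow> l \<le> psi \<alpha> t \<and> psi \<alpha> t \<le> u"
    using psi_bounds[OF 4] by metis
  then have "\<exists>a b. 0 < a \<and> (\<forall>z\<in>{0<..<1}. a \<le> C z \<and> C z \<le> b)"
    unfolding C_def by (intro exI[of _ l] exI[of _ u]) auto
  moreover have "C real_analytic_on {0<..<1}"
    using psi_neg_ln_real_analytic[of \<alpha>] by (simp add: C_def[abs_def])
  moreover have "E \<in> O[at_left 1](\<lambda>z. 1 - z)"
    using f_asymptotics[OF \<alpha>] by (simp add: E_def[abs_def] C_def)
  moreover have "\<forall>\<^sub>F z in at_left 1. f z = C z / (1 - z) powr (log 2 \<rho>) * (1 + E z)"
  proof (rule eventually_at_leftI[of 0])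
    fix z :: real assume "z \<in> {0<..<1}"
    then show "f z = C z / (1 - z) powr (log 2 \<rho>) * (1 + E z)"
      using C_pos[of z] by (simp add: E_def \<alpha>_def)
  qed simp
  ultimately show ?thesis using C_pos by blast
qed

end
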